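(* Let $A,B\subseteq\omega$. If $B$ is Church stochastic relative to $A$ then $\Gamma_B(A)\ge 1/2$. Consequently, if $A$ and $B$ are Church stochastic relative to each other, then $H(A,B)=1/2$.
   Context: For $X\subseteq\omega$ and $n\ge1$, $\rho_n(X)=|X\cap[0,n)|/n$; $\underline{\rho}(X)=\liminf_n\rho_n(X)$, $\overline{\rho}(X)=\limsup_n\rho_n(X)$. For sets $X,D$, $\gamma_D(X)$ is the supremum of all $r$ such that there is $Y\le_T D$ with $\underline{\rho}(\{n: X(n)=Y(n)\})\ge r$. For sets $C,A$, $\Gamma_C(A)=\inf\{\gamma_C(X): X\le_T A\}$. Coarse similarity: $X\sim Y$ iff $\lim_n\rho_n(X\bigtriangleup Y)=0$; $\mathcal{S}$ is the set of classes $[X]$ with metric $\delta([X],[Y])=\overline{\rho}(X\bigtriangleup Y)$. $H(A,B)$ is the Hausdorff distance in $(\mathcal{S},\delta)$ between the closures of $\{[X]:X\le_T A\}$ and $\{[X]:X\le_T B\}$. $B$ is Church stochastic relative to $A$ if for every partial $A$-computable selection rule $f:2^{<\omega}\to\{0,1\}$ that is total on all initial segments of $B$ and selects infinitely many positions $n$ (those with $f(B\upharpoonright n)=1$), the proportion of $1$'s among the first $k$ selected bits of $B$ tends to $1/2$ as $k\to\infty$. *)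

theory Defs
  imports "HOL-Analysis.Analysis" "HOL-Library.Nat_Bijection"
begin

section \<open>Partial recursive functions relative to an oracle\<close>

datatype oracle_prog =
    Zero
  | Succ
  | Proj nat
  | Oracle
  | Comp oracle_prog "oracle_prog list"
  | PrimRec oracle_prog oracle_prog
  | Mu oracle_prog

text \<open>\<^prop>\<open>computes A p xs y\<close>: with oracle \<^term>\<open>A\<close>, the program \<^term>\<open>p\<close> halts on the argument tuple
  \<^term>\<open>xs\<close> with value \<^term>\<open>y\<close>. Recursion and minimisation act on the first argument.\<close>

inductive computes :: "nat set \<Rightarrow> oracle_prog \<Rightarrow> nat list \<Rightarrow> nat \<Rightarrow> bool" for A :: "nat set" where
  zero: "computes A Zero xs 0"
| succ: "computes A Succ [x] (Suc x)"
| proj: "i < length xs \<Longrightarrow> computes A (Proj i) xs (xs ! i)"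
| query: "computes A Oracle [x] (of_bool (x \<in> A))"
| comp: "list_all2 (\<lambda>g y. computes A g xs y) gs ys \<Longrightarrow> computes A f ys z
    \<Longrightarrow> computes A (Comp f gs) xs z"
| prim_zero: "computes A f xs y \<Longrightarrow> computes A (PrimRec f g) (0 # xs) y"
| prim_suc: "computes A (PrimRec f g) (n # xs) y \<Longrightarrow> computes A g (n # y # xs) z
    \<Longrightarrow> computes A (PrimRec f g) (Suc n # xs) z"
| mu: "computes A f (n # xs) 0 \<Longrightarrow> (\<forall>m<n. \<exists>y. computes A f (m # xs) (Suc y))
    \<Longrightarrow> computes A (Mu f) xs n"

lemma computes_deterministic: "computes A p xs y \<Longrightarrow> computes A p xs z \<Longrightarrow> y = z"
proof (induction arbitrary: z rule: computes.induct)
  case (comp xs gs ys f y)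
  from comp.prems obtain ys' where ys': "list_all2 (\<lambda>g y. computes A g xs y) gs ys'" "computes A f ys' z"
    by cases auto
  have "ys = ys'"
    using comp.IH(1) ys'(1) by (auto simp: list_all2_conv_all_nth intro!: nth_equalityI)
  then show ?case using comp.IH(2) ys'(2) by blast
next
  case (mu f n xs)
  from mu.prems have z: "computes A f (z # xs) 0" "\<forall>m<z. \<exists>y. computes A f (m # xs) (Suc y)"
    by (cases, auto)+
  show ?case
    using mu.IH z by (metis nat.distinct(1) linorder_neqE_nat)
next
  case (prim_zero f xs y g)
  from prim_zero.prems have "computes A f xs z" by cases auto
  then show ?case by (rule prim_zero.IH)
next
  case (prim_suc f g n xs y z')
  from prim_suc.prems obtain w where w: "computes A (PrimRec f g) (n # xs) w" "computes A g (n # w # xs) z"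
    by cases auto
  then show ?case using prim_suc.IH by metis
next
  case (zero xs)
  then show ?case by cases auto
next
  case (succ x)
  then show ?case by cases auto
next
  case (proj i xs)
  from proj.prems show ?case by cases auto
next
  case (query x)
  then show ?case by cases auto
qed

definition partial_computable_in :: "nat set \<Rightarrow> (nat \<Rightarrow> nat option) \<Rightarrow> bool" where
  "partial_computable_in A f \<longleftrightarrow> (\<exists>p. \<forall>x y. computes A p [x] y \<longleftrightarrow> f x = Some y)"

definition turing_le :: "nat set \<Rightarrow> nat set \<Rightarrow> bool"  (infix "\<le>\<^sub>T" 50) where
  "X \<le>\<^sub>T A \<longleftrightarrow> partial_computable_in A (\<lambda>n. Some (of_bool (n \<in> X)))"

section \<open>Asymptotic density\<close>

text \<open>The value at \<^term>\<open>n = 0\<close> is the junk value \<^term>\<open>0\<close>; only limits in \<^term>\<open>n\<close> are used.\<close>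

definition rho :: "nat \<Rightarrow> nat set \<Rightarrow> real" where
  "rho n X = real (card (X \<inter> {0..<n})) / real n"

definition lower_density :: "nat set \<Rightarrow> real" where
  "lower_density X = real_of_ereal (liminf (\<lambda>n. ereal (rho n X)))"

definition upper_density :: "nat set \<Rightarrow> real" where
  "upper_density X = real_of_ereal (limsup (\<lambda>n. ereal (rho n X)))"

definition coarse_gamma :: "nat set \<Rightarrow> nat set \<Rightarrow> real" where
  "coarse_gamma D X = Sup {r. \<exists>Y. Y \<le>\<^sub>T D \<and> r \<le> lower_density {n. n \<in> X \<longleftrightarrow> n \<in> Y}}"

definition coarse_Gamma :: "nat set \<Rightarrow> nat set \<Rightarrow> real" where
  "coarse_Gamma C A = Inf {coarse_gamma C X | X. X \<le>\<^sub>T A}"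

lemma rho_nonneg: "0 \<le> rho n X"
  by (simp add: rho_def)

lemma rho_le_1: "rho n X \<le> 1"
proof -
  have "card (X \<inter> {0..<n}) \<le> n"
    using card_mono[of "{0..<n}" "X \<inter> {0..<n}"] by simp
  then show ?thesis
    by (cases "n = 0") (simp_all add: rho_def)
qed

lemma rho_mono: "X \<subseteq> Y \<Longrightarrow> rho n X \<le> rho n Y"
  unfolding rho_def by (intro divide_right_mono) (auto intro!: card_mono)

lemma rho_Un: "rho n (X \<union> Y) \<le> rho n X + rho n Y"
proof -
  have "card ((X \<union> Y) \<inter> {0..<n}) \<le> card (X \<inter> {0..<n}) + card (Y \<inter> {0..<n})"
    by (simp add: Int_Un_distrib2 card_Un_le)
  then show ?thesis
    unfolding rho_def by (metis add_divide_distrib divide_right_mono of_nat_0_le_iff of_nat_add of_nat_mono)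
qed

lemma rho_empty [simp]: "rho n {} = 0"
  by (simp add: rho_def)

lemma ereal_upper_density: "ereal (upper_density X) = limsup (\<lambda>n. ereal (rho n X))"
proof -
  have "0 \<le> limsup (\<lambda>n. ereal (rho n X))"
    using rho_nonneg by (intro le_Limsup) auto
  moreover have "limsup (\<lambda>n. ereal (rho n X)) \<le> 1"
    using rho_le_1 by (intro Limsup_bounded) auto
  ultimately show ?thesis
    unfolding upper_density_def by (intro ereal_real') auto
qed

lemma ereal_lower_density: "ereal (lower_density X) = liminf (\<lambda>n. ereal (rho n X))"
proof -
  have "0 \<le> liminf (\<lambda>n. ereal (rho n X))"
    using rho_nonneg by (intro Liminf_bounded) auto
  moreover have "liminf (\<lambda>n. ereal (rho n X)) \<le> 1"
    using rho_le_1 by (intro Liminf_le) auto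
  ultimately show ?thesis
    unfolding lower_density_def by (intro ereal_real') auto
qed

lemma upper_density_nonneg: "0 \<le> upper_density X"
proof -
  have "0 \<le> limsup (\<lambda>n. ereal (rho n X))"
    using rho_nonneg by (intro le_Limsup) auto
  then show ?thesis by (simp flip: ereal_upper_density)
qed

lemma upper_density_mono_Un:
  assumes "X \<subseteq> Y \<union> Z"
  shows "upper_density X \<le> upper_density Y + upper_density Z"
proof -
  have "ereal (rho n X) \<le> ereal (rho n Y) + ereal (rho n Z)" for n
    using rho_mono[OF assms, of n] rho_Un[of n Y Z] by simp
  then have "limsup (\<lambda>n. ereal (rho n X)) \<le> limsup (\<lambda>n. ereal (rho n Y) + ereal (rho n Z))"
    by (intro Limsup_mono always_eventually allI)
  also have "\<dots> \<le> limsup (\<lambda>n. ereal (rho n Y)) + limsup (\<lambda>n. ereal (rho n Z))"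
    by (rule ereal_limsup_add_mono)
  finally show ?thesis
    by (simp flip: ereal_upper_density)
qed

lemma upper_density_eq_0_iff: "upper_density X = 0 \<longleftrightarrow> (\<lambda>n. rho n X) \<longlonglongrightarrow> 0"
proof
  assume "upper_density X = 0"
  then have "limsup (\<lambda>n. ereal (rho n X)) \<le> 0"
    by (simp flip: ereal_upper_density)
  moreover have "0 \<le> liminf (\<lambda>n. ereal (rho n X))"
    using rho_nonneg by (intro Liminf_bounded) auto
  moreover have "liminf (\<lambda>n. ereal (rho n X)) \<le> limsup (\<lambda>n. ereal (rho n X))"
    by (rule Liminf_le_Limsup) simp
  ultimately have "liminf (\<lambda>n. ereal (rho n X)) = 0" "limsup (\<lambda>n. ereal (rho n X)) = 0"
    by (auto intro: antisym order_trans)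
  then have "(\<lambda>n. ereal (rho n X)) \<longlonglongrightarrow> 0"
    by (intro Liminf_eq_Limsup) auto
  then show "(\<lambda>n. rho n X) \<longlonglongrightarrow> 0"
    by (simp add: zero_ereal_def)
next
  assume "(\<lambda>n. rho n X) \<longlonglongrightarrow> 0"
  then have "(\<lambda>n. ereal (rho n X)) \<longlonglongrightarrow> 0"
    by (simp add: zero_ereal_def)
  then have "limsup (\<lambda>n. ereal (rho n X)) = 0"
    by (intro lim_imp_Limsup) auto
  then show "upper_density X = 0"
    by (simp add: upper_density_def)
qed

section \<open>The space of coarse similarity classes\<close>

definition coarse_similar :: "nat set \<Rightarrow> nat set \<Rightarrow> bool" where
  "coarse_similar X Y \<longleftrightarrow> (\<lambda>n. rho n (sym_diff X Y)) \<longlonglongrightarrow> 0"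

lemma coarse_similar_iff: "coarse_similar X Y \<longleftrightarrow> upper_density (sym_diff X Y) = 0"
  by (simp add: coarse_similar_def upper_density_eq_0_iff)

lemma upper_density_triangle:
  "upper_density (sym_diff X Z) \<le> upper_density (sym_diff X Y) + upper_density (sym_diff Y Z)"
  by (rule upper_density_mono_Un) blast

lemma upper_density_commute: "upper_density (sym_diff X Y) = upper_density (sym_diff Y X)"
  by (simp add: Un_commute)

lemma equivp_coarse_similar: "equivp coarse_similar"
proof (rule equivpI)
  show "reflp coarse_similar"
    by (simp add: reflp_def coarse_similar_def)
  show "symp coarse_similar"
    by (simp add: symp_def coarse_similar_def Un_commute)
  show "transp coarse_similar"
    unfolding transp_def coarse_similar_iff
    by (metis add_0 antisym upper_density_nonneg upper_density_triangle)
qed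

quotient_type coarse_class = "nat set" / coarse_similar
  morphisms rep_coarse_class coarse_class_of
  by (rule equivp_coarse_similar)

instantiation coarse_class :: metric_space
begin

lift_definition dist_coarse_class :: "coarse_class \<Rightarrow> coarse_class \<Rightarrow> real"
  is "\<lambda>X Y. upper_density (sym_diff X Y)"
proof -
  fix X X' Y Y' :: "nat set"
  assume "coarse_similar X X'" "coarse_similar Y Y'"
  then have *: "upper_density (sym_diff X X') = 0" "upper_density (sym_diff Y Y') = 0"
    by (simp_all only: coarse_similar_iff)
  then have **: "upper_density (sym_diff X' X) = 0" "upper_density (sym_diff Y' Y) = 0"
    by (simp_all only: upper_density_commute[of X' X] upper_density_commute[of Y' Y])
  show "upper_density (sym_diff X Y) = upper_density (sym_diff X' Y')"
  proof (rule antisym)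
    show "upper_density (sym_diff X Y) \<le> upper_density (sym_diff X' Y')"
      using upper_density_triangle[of X Y X'] upper_density_triangle[of X' Y Y'] * ** by linarith
    show "upper_density (sym_diff X' Y') \<le> upper_density (sym_diff X Y)"
      using upper_density_triangle[of X' Y' X] upper_density_triangle[of X Y' Y] * ** by linarith
  qed
qed

definition uniformity_coarse_class :: "(coarse_class \<times> coarse_class) filter" where
  "uniformity_coarse_class = (INF e\<in>{0<..}. principal {(x, y). dist x y < e})"

definition open_coarse_class :: "coarse_class set \<Rightarrow> bool" where
  "open_coarse_class U = (\<forall>x\<in>U. eventually (\<lambda>(x', y). x' = x \<longrightarrow> y \<in> U) uniformity)"

instance
proof
  fix x y z :: coarse_class
  show "dist x y = 0 \<longleftrightarrow> x = y"
    by transfer (simp only: coarse_similar_iff)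
  show "dist x y \<le> dist x z + dist y z"
    by transfer (metis upper_density_triangle upper_density_commute)
qed (rule uniformity_coarse_class_def open_coarse_class_def)+

end

definition hausdorff_distance :: "'a::metric_space set \<Rightarrow> 'a set \<Rightarrow> real" where
  "hausdorff_distance S T = max (SUP x\<in>S. infdist x T) (SUP y\<in>T. infdist y S)"

definition coarse_H :: "nat set \<Rightarrow> nat set \<Rightarrow> real" where
  "coarse_H A B = hausdorff_distance (closure {coarse_class_of X | X. X \<le>\<^sub>T A})
                              (closure {coarse_class_of X | X. X \<le>\<^sub>T B})"

section \<open>Church stochasticity\<close>

definition initial_segment :: "nat set \<Rightarrow> nat \<Rightarrow> bool list" where
  "initial_segment B n = map (\<lambda>i. i \<in> B) [0..<n]"

text \<open>Binary strings are coded as numbers by \<^const>\<open>list_encode\<close>; \<^const>\<open>None\<close> means divergence.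
  The coding function may behave arbitrarily on numbers that do not code binary strings.\<close>

definition partial_computable_rule_in :: "nat set \<Rightarrow> (bool list \<Rightarrow> bool option) \<Rightarrow> bool" where
  "partial_computable_rule_in A f \<longleftrightarrow>
    (\<exists>g. partial_computable_in A g \<and>
      (\<forall>\<sigma>. g (list_encode (map of_bool \<sigma>)) = map_option of_bool (f \<sigma>)))"

definition selected_positions :: "(bool list \<Rightarrow> bool option) \<Rightarrow> nat set \<Rightarrow> nat set" where
  "selected_positions f B = {n. f (initial_segment B n) = Some True}"

text \<open>\<^term>\<open>enumerate (selected_positions f B) i\<close> is the \<^term>\<open>i\<close>-th selected position
  in increasing order.\<close>

definition church_stochastic_relative :: "nat set \<Rightarrow> nat set \<Rightarrow> bool" where
  "church_stochastic_relative B A \<longleftrightarrow>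
    (\<forall>f. partial_computable_rule_in A f
        \<longrightarrow> (\<forall>n. f (initial_segment B n) \<noteq> None)
        \<longrightarrow> infinite (selected_positions f B)
        \<longrightarrow> (\<lambda>k. real (card {i. i < k \<and> enumerate (selected_positions f B) i \<in> B}) / real k)
              \<longlonglongrightarrow> 1 / 2)"

end

(* If X is computable from A, the rules reading X and its complement off the length of the string
   are A-computable, so B has density 1/2 within X and within the complement of X; hence X and B
   agree on a set of density exactly 1/2. This bounds Gamma via Y = B. If stochasticity is
   mutual, every X computable from A is at distance 1/2 from B and A is at distance 1/2
   from every Y computable from B, and symmetrically. *)

theory Submission
  imports Defs
begin

section \<open>Computing the length of a coded list\<close>

lemma computes_comp1:
  "computes A g xs y \<Longrightarrow> computes A f [y] z \<Longrightarrow> computes A (Comp f [g]) xs z"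
  by (rule computes.comp[where ys = "[y]"]) simp_all

lemma computes_comp2:
  "computes A g xs y \<Longrightarrow> computes A h xs y' \<Longrightarrow> computes A f [y, y'] z \<Longrightarrow> computes A (Comp f [g, h]) xs z"
  by (rule computes.comp[where ys = "[y, y']"]) simp_all

lemma computes_proj0: "computes A (Proj 0) (x # xs) x"
  using computes.proj[of 0 "x # xs" A] by simp

lemma computes_proj1: "computes A (Proj 1) (x # y # xs) y"
  using computes.proj[of 1 "x # y # xs" A] by simp

text \<open>In a recursion step the counter comes first and the previous value second, so
  \<open>Proj 0\<close> returns the counter here, and \<open>Proj 1\<close> the previous value in
  the primitive recursions below.\<close>

definition pred_prog :: oracle_prog where
  "pred_prog = PrimRec Zero (Proj 0)"

lemma computes_pred: "computes A pred_prog [n] (n - 1)"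
proof (induction n)
  case 0
  show ?case
    using computes.prim_zero[OF computes.zero] by (simp add: pred_prog_def)
next
  case (Suc n)
  show ?case
    using computes.prim_suc[OF Suc[unfolded pred_prog_def] computes_proj0] by (simp add: pred_prog_def)
qed

definition add_prog :: oracle_prog where
  "add_prog = PrimRec (Proj 0) (Comp Succ [Proj 1])"

lemma computes_add: "computes A add_prog [n, m] (n + m)"
proof (induction n)
  case 0
  show ?case
    using computes.prim_zero[OF computes_proj0] by (simp add: add_prog_def)
next
  case (Suc n)
  show ?case
    using computes.prim_suc[OF Suc[unfolded add_prog_def]
        computes_comp1[OF computes_proj1 computes.succ]]
    by (simp add: add_prog_def)
qed

text \<open>Recursion acts on the first argument, so the subtrahend comes first. The truncated
  difference vanishes exactly when the second argument is at most the first, which turns an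
  inequality into a search for a zero.\<close>

definition sub_prog :: oracle_prog where
  "sub_prog = PrimRec (Proj 0) (Comp pred_prog [Proj 1])"

lemma computes_sub: "computes A sub_prog [n, m] (m - n)"
proof (induction n)
  case 0
  show ?case
    using computes.prim_zero[OF computes_proj0] by (simp add: sub_prog_def)
next
  case (Suc n)
  show ?case
    using computes.prim_suc[OF Suc[unfolded sub_prog_def]
        computes_comp1[OF computes_proj1 computes_pred]]
    by (simp add: sub_prog_def)
qed

definition triangle_prog :: oracle_prog where
  "triangle_prog = PrimRec Zero (Comp add_prog [Proj 1, Comp Succ [Proj 0]])"

lemma computes_triangle: "computes A triangle_prog [n] (triangle n)"
proof (induction n)
  case 0
  show ?case
    using computes.prim_zero[OF computes.zero] by (simp add: triangle_prog_def)
next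
  case (Suc n)
  show ?case
    using computes.prim_suc[OF Suc[unfolded triangle_prog_def]
        computes_comp2[OF computes_proj1 computes_comp1[OF computes_proj0 computes.succ] computes_add]]
    by (simp add: triangle_prog_def)
qed

section \<open>Decoding lists through the triangular numbers\<close>

lemma mono_triangle: "m \<le> n \<Longrightarrow> triangle m \<le> triangle n"
  by (rule lift_Suc_mono_le[of triangle]) simp_all

lemma le_triangle_Suc: "n \<le> triangle (Suc n)"
  by simp

text \<open>For c = \<open>Suc (prod_encode (x, y))\<close> this is the diagonal x + y: c lies
  strictly above \<open>triangle (x + y)\<close> and, because of the \<open>Suc\<close>, may reach
  \<open>triangle (Suc (x + y))\<close>.\<close>

definition next_triangle_index :: "nat \<Rightarrow> nat" where
  "next_triangle_index c = (LEAST s. c \<le> triangle (Suc s))"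

definition next_triangle_index_prog :: oracle_prog where
  "next_triangle_index_prog =
    Mu (Comp sub_prog [Comp triangle_prog [Comp Succ [Proj 0]], Proj 1])"

lemma computes_next_triangle_index:
  "computes A next_triangle_index_prog [c] (next_triangle_index c)"
proof -
  have *: "computes A (Comp sub_prog [Comp triangle_prog [Comp Succ [Proj 0]], Proj 1]) [s, c]
      (c - triangle (Suc s))" for s
    by (intro computes_comp2[OF _ computes_proj1 computes_sub]
        computes_comp1[OF _ computes_triangle] computes_comp1[OF computes_proj0 computes.succ])
  have "c - triangle (Suc (next_triangle_index c)) = 0"
    using LeastI[of "\<lambda>s. c \<le> triangle (Suc s)", OF le_triangle_Suc] by (simp add: next_triangle_index_def)
  moreover have "\<exists>y. c - triangle (Suc s) = Suc y" if "s < next_triangle_index c" for s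
  proof -
    have "\<not> c \<le> triangle (Suc s)"
      using that not_less_Least unfolding next_triangle_index_def by blast
    then show ?thesis
      by presburger
  qed
  ultimately show ?thesis
    unfolding next_triangle_index_prog_def by (intro computes.mu) (metis *)+
qed

text \<open>Since \<^term>\<open>prod_encode\<close> enumerates pairs along the diagonals, whose ends are the triangular
  numbers, the code of the tail is the distance from the code of the list to the next
  triangular number.\<close>

definition code_tail :: "nat \<Rightarrow> nat" where
  "code_tail c = triangle (Suc (next_triangle_index c)) - c"

lemma code_tail_Cons: "code_tail (list_encode (x # xs)) = list_encode xs"
proof -
  define s where "s = x + list_encode xs"
  have c: "list_encode (x # xs) = Suc (triangle s + x)"
    by (simp add: s_def prod_encode_def)
  have "next_triangle_index (list_encode (x # xs)) = s"
    unfolding next_triangle_index_def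
  proof (rule Least_equality)
    show "list_encode (x # xs) \<le> triangle (Suc s)"
      unfolding c by (simp add: s_def)
  next
    fix t assume "list_encode (x # xs) \<le> triangle (Suc t)"
    then have "triangle s < triangle (Suc t)"
      unfolding c by linarith
    then show "s \<le> t"
      using mono_triangle[of "Suc t" s] by (metis not_less not_less_eq_eq)
  qed
  then show ?thesis
    unfolding code_tail_def c by (simp add: s_def)
qed

definition code_tail_prog :: oracle_prog where
  "code_tail_prog =
    Comp sub_prog [Proj 0, Comp triangle_prog [Comp Succ [next_triangle_index_prog]]]"

lemma computes_code_tail: "computes A code_tail_prog [c] (code_tail c)"
  unfolding code_tail_prog_def code_tail_def
  by (intro computes_comp2[OF computes_proj0 _ computes_sub] computes_comp1[OF _ computes_triangle]
      computes_comp1[OF computes_next_triangle_index computes.succ])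

lemma computes_code_tail_funpow:
  "computes A (PrimRec (Proj 0) (Comp code_tail_prog [Proj 1])) [k, c] ((code_tail ^^ k) c)"
proof (induction k)
  case 0
  show ?case
    using computes.prim_zero[OF computes_proj0] by simp
next
  case (Suc k)
  show ?case
    using computes.prim_suc[OF Suc computes_comp1[OF computes_proj1 computes_code_tail]] by simp
qed

lemma code_tail_funpow:
  "k \<le> length xs \<Longrightarrow> (code_tail ^^ k) (list_encode xs) = list_encode (drop k xs)"
proof (induction k)
  case (Suc k)
  then have "drop k xs = xs ! k # drop (Suc k) xs"
    by (simp add: Cons_nth_drop_Suc)
  with Suc show ?case
    by (simp add: code_tail_Cons del: list_encode.simps)
qed simp

definition length_prog :: oracle_prog where
  "length_prog = Mu (PrimRec (Proj 0) (Comp code_tail_prog [Proj 1]))"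

text \<open>Only the empty list has code 0, so the length is the least number of tails after which
  the code is 0.\<close>

lemma computes_length: "computes A length_prog [list_encode xs] (length xs)"
  unfolding length_prog_def
proof (rule computes.mu, goal_cases)
  case 1
  show ?case
    using computes_code_tail_funpow[of A "length xs" "list_encode xs"] by (simp add: code_tail_funpow)
next
  case 2
  have "\<exists>y. (code_tail ^^ k) (list_encode xs) = Suc y" if "k < length xs" for k
    using that by (simp add: code_tail_funpow flip: Cons_nth_drop_Suc)
  then show ?case
    by (metis computes_code_tail_funpow)
qed

section \<open>Selection rules from computable sets\<close>

lemma turing_leI:
  assumes "\<And>n. computes A p [n] (of_bool (n \<in> X))"
  shows "X \<le>\<^sub>T A"
  unfolding turing_le_def partial_computable_in_def
  using assms computes_deterministic by (metis option.inject)

lemma turing_leE: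
  assumes "X \<le>\<^sub>T A"
  obtains p where "\<And>n. computes A p [n] (of_bool (n \<in> X))"
  using assms unfolding turing_le_def partial_computable_in_def by auto

lemma turing_le_refl: "A \<le>\<^sub>T A"
  by (rule turing_leI) (rule computes.query)

lemma turing_le_Compl:
  assumes "X \<le>\<^sub>T A"
  shows "- X \<le>\<^sub>T A"
proof -
  obtain p where p: "computes A p [n] (of_bool (n \<in> X))" for n
    using assms turing_leE by blast
  have "computes A (Comp sub_prog [p, Comp Succ [Zero]]) [n] (1 - of_bool (n \<in> X))" for n
    using computes_comp2[OF p computes_comp1[OF computes.zero computes.succ] computes_sub] by simp
  moreover have "1 - of_bool (n \<in> X) = (of_bool (n \<in> - X) :: nat)" for n
    by simp
  ultimately show ?thesis
    by (metis turing_leI)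
qed

text \<open>By determinism every program defines a partial function. This supplies the coding
  function of a selection rule without a description of it on numbers that do not code binary
  strings.\<close>

lemma partial_computable_in_prog:
  "partial_computable_in A (\<lambda>x. if \<exists>y. computes A p [x] y then Some (THE y. computes A p [x] y) else None)"
proof -
  have "(THE y. computes A p [x] y) = y" if "computes A p [x] y" for x y
    using that by (rule the_equality) (rule computes_deterministic[OF _ that])
  then show ?thesis
    unfolding partial_computable_in_def by (intro exI[of _ p]) auto
qed

lemma partial_computable_rule_in_length:
  assumes "X \<le>\<^sub>T A"
  shows "partial_computable_rule_in A (\<lambda>\<sigma>. Some (length \<sigma> \<in> X))"
proof -
  obtain p where p: "computes A p [n] (of_bool (n \<in> X))" for n
    using assms turing_leE by blast
  define q where "q = Comp p [length_prog]"
  define g where "g x = (if \<exists>y. computes A q [x] y then Some (THE y. computes A q [x] y) else None)" for x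
  have q: "computes A q [list_encode xs] (of_bool (length xs \<in> X))" for xs
    unfolding q_def by (rule computes_comp1[OF computes_length p])
  have "(THE y. computes A q [list_encode xs] y) = of_bool (length xs \<in> X)" for xs
    by (rule the_equality) (rule q, rule computes_deterministic[OF _ q])
  then have "g (list_encode xs) = Some (of_bool (length xs \<in> X))" for xs
    using q[of xs] unfolding g_def by auto
  moreover have "partial_computable_in A g"
    unfolding g_def by (rule partial_computable_in_prog)
  ultimately show ?thesis
    unfolding partial_computable_rule_in_def by (intro exI[of _ g]) simp
qed

section \<open>Density of agreement\<close>

text \<open>By monotonicity the indices of elements below n form an initial segment, which ends
  because the n-th element is at least n. The enumeration maps it bijectively onto the part of S
  below n, so its length is that cardinality.\<close>

lemma enumerate_less_iff:
  fixes S :: "nat set"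
  assumes "infinite S"
  shows "enumerate S i < n \<longleftrightarrow> i < card (S \<inter> {0..<n})"
proof -
  let ?I = "{i. enumerate S i < n}"
  have img: "enumerate S ` ?I = S \<inter> {0..<n}"
    using assms enumerate_in_set enumerate_Ex[of S] by fastforce
  have inj: "inj_on (enumerate S) ?I"
    using assms by (meson inj_enumerate inj_on_subset subset_UNIV)
  define k where "k = (LEAST k. k \<notin> ?I)"
  have "n \<notin> {i. enumerate S i < n}"
    using le_enumerate[OF assms, of n] by simp
  then have "k \<notin> ?I"
    unfolding k_def by (rule LeastI)
  have "i \<in> ?I \<longleftrightarrow> i < k" for i
  proof
    assume "i \<in> ?I"
    then have "enumerate S i < enumerate S k"
      using \<open>k \<notin> ?I\<close> by simp
    then show "i < k"
      using assms by simp
  next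
    assume "i < k"
    then show "i \<in> ?I"
      unfolding k_def by (blast dest: not_less_Least)
  qed
  then have "?I = {..<k}"
    by auto
  moreover have "card ?I = card (S \<inter> {0..<n})"
    using card_image[OF inj] by (simp add: img)
  ultimately show ?thesis
    by auto
qed

text \<open>This turns frequencies among the first selected bits into counts below n, as needed to
  pass from stochasticity to \<open>rho\<close>.\<close>

lemma card_enumerate_Int:
  fixes S :: "nat set"
  assumes "infinite S"
  shows "card {i. i < card (S \<inter> {0..<n}) \<and> enumerate S i \<in> B} = card (S \<inter> B \<inter> {0..<n})"
proof -
  have "enumerate S ` {i. enumerate S i < n \<and> enumerate S i \<in> B} = S \<inter> B \<inter> {0..<n}"
    using assms enumerate_in_set enumerate_Ex[of S] by fastforce
  moreover have "inj_on (enumerate S) T" for T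
    using assms by (meson inj_enumerate inj_on_subset subset_UNIV)
  ultimately show ?thesis
    by (metis (no_types, lifting) Collect_cong assms card_image enumerate_less_iff)
qed

lemma filterlim_card_Int_at_top:
  fixes S :: "nat set"
  assumes "infinite S"
  shows "filterlim (\<lambda>n. card (S \<inter> {0..<n})) sequentially sequentially"
  unfolding filterlim_at_top
proof
  fix k
  have "k \<le> card (S \<inter> {0..<n})" if "n \<ge> Suc (enumerate S k)" for n
    using that enumerate_less_iff[OF assms, of k n] by simp
  then show "\<forall>\<^sub>F n in sequentially. k \<le> card (S \<inter> {0..<n})"
    by (auto simp: eventually_sequentially)
qed

lemma rho_finite_tendsto_0:
  assumes "finite S"
  shows "(\<lambda>n. rho n S) \<longlonglongrightarrow> 0"
proof (rule tendsto_sandwich)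
  show "\<forall>\<^sub>F n in sequentially. 0 \<le> rho n S"
    by (simp add: rho_nonneg)
  show "\<forall>\<^sub>F n in sequentially. rho n S \<le> real (card S) / real n"
    using assms by (auto simp: rho_def intro!: divide_right_mono card_mono always_eventually)
  show "(\<lambda>n. real (card S) / real n) \<longlonglongrightarrow> 0"
    by (rule lim_const_over_n)
qed simp

text \<open>The density of S need not exist, so the two densities are compared by their
  difference.\<close>

lemma rho_Int_tendsto_half:
  assumes "church_stochastic_relative B A" "S \<le>\<^sub>T A"
  shows "(\<lambda>n. rho n (S \<inter> B) - rho n S / 2) \<longlonglongrightarrow> 0"
\<comment> \<open>For finite S stochasticity says nothing, but both densities tend to 0.\<close>
proof (cases "finite S")
  case True
  then have "(\<lambda>n. rho n (S \<inter> B) - rho n S / 2) \<longlonglongrightarrow> 0 - 0 / 2"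
    by (intro tendsto_intros rho_finite_tendsto_0) auto
  then show ?thesis
    by simp
next
  case False
  define k where "k n = card (S \<inter> {0..<n})" for n
  define a where "a n = card (S \<inter> B \<inter> {0..<n})" for n
  have selected: "selected_positions (\<lambda>\<sigma>. Some (length \<sigma> \<in> S)) B = S"
    by (simp add: selected_positions_def initial_segment_def)
  have "(\<lambda>k. real (card {i. i < k \<and> enumerate S i \<in> B}) / real k) \<longlonglongrightarrow> 1 / 2"
    using assms(1)[unfolded church_stochastic_relative_def, rule_format,
        OF partial_computable_rule_in_length[OF assms(2)]] False
    unfolding selected by blast
  \<comment> \<open>The limit is taken along the number of elements of S below n, which tends to
    infinity.\<close>
  from filterlim_compose[OF this filterlim_card_Int_at_top[OF False]]
  have "(\<lambda>n. real (a n) / real (k n)) \<longlonglongrightarrow> 1 / 2"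
    by (simp add: card_enumerate_Int[OF False] a_def k_def)
  then have lim: "(\<lambda>n. real (a n) / real (k n) - 1 / 2) \<longlonglongrightarrow> 0"
    by (simp add: LIM_zero_iff)
  have rho: "rho n S = real (k n) / real n" "rho n (S \<inter> B) = real (a n) / real n" for n
    by (simp_all add: rho_def k_def a_def)
  \<comment> \<open>Where S has no element below n, the quotient is 0 / 0 = 0, and both sides vanish
    since \<open>rho n S\<close> does.\<close>
  have eq: "rho n (S \<inter> B) - rho n S / 2 = rho n S * (real (a n) / real (k n) - 1 / 2)" for n
  proof (cases "k n = 0")
    case True
    then have "rho n S = 0"
      by (simp add: rho)
    moreover have "rho n (S \<inter> B) \<le> rho n S"
      by (rule rho_mono) simp
    ultimately show ?thesis
      using rho_nonneg[of n "S \<inter> B"] by simp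
  next
    case False
    then show ?thesis
      by (cases "n = 0") (simp_all add: rho field_simps)
  qed
  \<comment> \<open>The factor \<open>rho n S\<close> lies in [0, 1], so the other factor dominates
    the product.\<close>
  have "(\<lambda>n. rho n S * (real (a n) / real (k n) - 1 / 2)) \<longlonglongrightarrow> 0"
  proof (rule Lim_null_comparison[OF _ tendsto_norm_zero[OF lim]])
    show "\<forall>\<^sub>F n in sequentially. norm (rho n S * (real (a n) / real (k n) - 1 / 2))
        \<le> norm (real (a n) / real (k n) - 1 / 2)"
      unfolding norm_mult using rho_nonneg rho_le_1
      by (intro always_eventually allI mult_left_le_one_le norm_ge_zero) auto
  qed
  then show ?thesis
    by (simp only: eq)
qed

section \<open>Density of the symmetric difference\<close>

lemma rho_Un_disjoint: "X \<inter> Y = {} \<Longrightarrow> rho n (X \<union> Y) = rho n X + rho n Y"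
  unfolding rho_def by (subst Int_Un_distrib2, subst card_Un_disjoint) (auto simp: add_divide_distrib)

lemma rho_UNIV: "n > 0 \<Longrightarrow> rho n UNIV = 1"
  by (simp add: rho_def)

lemma rho_sym_diff_tendsto_half:
  assumes "church_stochastic_relative B A" "X \<le>\<^sub>T A"
  shows "(\<lambda>n. rho n (sym_diff X B)) \<longlonglongrightarrow> 1 / 2"
proof -
  \<comment> \<open>The errors within X and within its complement are separated from the main term
    1/2. At n = 0 the junk value of \<open>rho\<close> breaks the identity, so it is used only
    eventually.\<close>
  have eq: "1 / 2 - (rho n (X \<inter> B) - rho n X / 2) + (rho n (- X \<inter> B) - rho n (- X) / 2)
      = rho n (sym_diff X B)" if "n > 0" for n
  proof -
    have "rho n X + rho n (- X) = 1"
      using rho_Un_disjoint[of X "- X" n] rho_UNIV[OF that] by simp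
    moreover have "X = X \<inter> B \<union> (X - B)"
      by blast
    then have "rho n X = rho n (X \<inter> B) + rho n (X - B)"
      using rho_Un_disjoint[of "X \<inter> B" "X - B" n] by auto
    moreover have "rho n (sym_diff X B) = rho n (X - B) + rho n (- X \<inter> B)"
      using rho_Un_disjoint[of "X - B" "B - X" n] by (simp add: Diff_eq Int_commute disjoint_iff)
    ultimately show ?thesis
      by argo
  qed
  have "(\<lambda>n. 1 / 2 - (rho n (X \<inter> B) - rho n X / 2) + (rho n (- X \<inter> B) - rho n (- X) / 2))
      \<longlonglongrightarrow> 1 / 2 - 0 + 0"
    using assms by (intro tendsto_intros rho_Int_tendsto_half turing_le_Compl)
  then have "(\<lambda>n. 1 / 2 - (rho n (X \<inter> B) - rho n X / 2) + (rho n (- X \<inter> B) - rho n (- X) / 2))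
      \<longlonglongrightarrow> 1 / 2"
    by simp
  moreover have "\<forall>\<^sub>F n in sequentially. 1 / 2 - (rho n (X \<inter> B) - rho n X / 2)
      + (rho n (- X \<inter> B) - rho n (- X) / 2) = rho n (sym_diff X B)"
    using eventually_gt_at_top[of 0] by eventually_elim (rule eq)
  ultimately show ?thesis
    by (rule Lim_transform_eventually)
qed

lemma upper_density_eq_lim:
  assumes "(\<lambda>n. rho n X) \<longlonglongrightarrow> l"
  shows "upper_density X = l"
  using lim_imp_Limsup[of sequentially "\<lambda>n. ereal (rho n X)" "ereal l"] assms
  by (simp add: upper_density_def)

lemma lower_density_eq_lim:
  assumes "(\<lambda>n. rho n X) \<longlonglongrightarrow> l"
  shows "lower_density X = l"
  using lim_imp_Liminf[of sequentially "\<lambda>n. ereal (rho n X)" "ereal l"] assms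
  by (simp add: lower_density_def)

text \<open>Agreeing with B is differing from it after complementing X, and the complement is again
  computable from A.\<close>

lemma rho_agree_tendsto_half:
  assumes "church_stochastic_relative B A" "X \<le>\<^sub>T A"
  shows "(\<lambda>n. rho n {n. n \<in> X \<longleftrightarrow> n \<in> B}) \<longlonglongrightarrow> 1 / 2"
proof -
  have "{n. n \<in> X \<longleftrightarrow> n \<in> B} = sym_diff (- X) B"
    by blast
  then show ?thesis
    using rho_sym_diff_tendsto_half[OF assms(1) turing_le_Compl[OF assms(2)]] by simp
qed

section \<open>The lower bound for \<open>coarse_Gamma\<close>\<close>

lemma lower_density_le_1: "lower_density X \<le> 1"
proof -
  have "liminf (\<lambda>n. ereal (rho n X)) \<le> 1"
    using rho_le_1 by (intro Liminf_le) auto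
  then show ?thesis
    by (simp flip: ereal_lower_density)
qed

lemma lower_density_le_coarse_gamma:
  assumes "Y \<le>\<^sub>T D"
  shows "lower_density {n. n \<in> X \<longleftrightarrow> n \<in> Y} \<le> coarse_gamma D X"
  unfolding coarse_gamma_def
proof (rule cSup_upper)
  \<comment> \<open>A real supremum bounds its set only if the set is bounded above; here 1 is a
    bound.\<close>
  show "bdd_above {r. \<exists>Y. Y \<le>\<^sub>T D \<and> r \<le> lower_density {n. n \<in> X \<longleftrightarrow> n \<in> Y}}"
    using lower_density_le_1 by (intro bdd_aboveI[where M = 1]) (auto intro: order_trans)
qed (use assms in auto)

lemma coarse_Gamma_ge_half:
  assumes "church_stochastic_relative B A"
  shows "coarse_Gamma B A \<ge> 1 / 2"
  unfolding coarse_Gamma_def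
proof (rule cInf_greatest)
  show "{coarse_gamma B X |X. X \<le>\<^sub>T A} \<noteq> {}"
    using turing_le_refl by blast
next
  fix r assume "r \<in> {coarse_gamma B X |X. X \<le>\<^sub>T A}"
  then obtain X where X: "X \<le>\<^sub>T A" "r = coarse_gamma B X"
    by blast
  then show "1 / 2 \<le> r"
    using lower_density_le_coarse_gamma[OF turing_le_refl, of X B]
      lower_density_eq_lim[OF rho_agree_tendsto_half[OF assms X(1)]] by simp
qed

section \<open>The Hausdorff distance\<close>

text \<open>The single point t of T keeps all of S within d, and the single point s of S stays at
  least d away from all of T. Both conditions are closed, so they survive passing to closures, and s
  attains the supremum.\<close>

lemma SUP_infdist_closure_eq:
  fixes S T :: "'a::metric_space set"
  assumes "s \<in> S" "t \<in> T" "\<And>x. x \<in> S \<Longrightarrow> dist x t \<le> d" "\<And>y. y \<in> T \<Longrightarrow> d \<le> dist s y"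
  shows "(SUP x\<in>closure S. infdist x (closure T)) = d"
proof (rule antisym)
  have "closure S \<subseteq> {x. infdist x (closure T) \<le> d}"
  proof (rule closure_minimal)
    show "S \<subseteq> {x. infdist x (closure T) \<le> d}"
      using assms(2,3) closure_subset by (blast intro: infdist_le2)
    show "closed {x. infdist x (closure T) \<le> d}"
      by (intro closed_Collect_le continuous_intros)
  qed
  then have upper: "infdist x (closure T) \<le> d" if "x \<in> closure S" for x
    using that by blast
  show "(SUP x\<in>closure S. infdist x (closure T)) \<le> d"
    using assms(1) closure_subset upper by (intro cSUP_least) auto
  have "closure T \<subseteq> {y. d \<le> dist s y}"
    using assms(4) by (intro closure_minimal closed_Collect_le continuous_intros) auto
  then have "d \<le> infdist s (closure T)"
    using assms(2) closure_subset by (subst infdist_notempty) (auto intro!: cINF_greatest)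
  also have "\<dots> \<le> (SUP x\<in>closure S. infdist x (closure T))"
    using assms(1) closure_subset upper by (intro cSUP_upper bdd_aboveI2) auto
  finally show "d \<le> (SUP x\<in>closure S. infdist x (closure T))" .
qed

lemma dist_coarse_class_half:
  assumes "church_stochastic_relative B A" "X \<le>\<^sub>T A"
  shows "dist (coarse_class_of X) (coarse_class_of B) = 1 / 2"
  using upper_density_eq_lim[OF rho_sym_diff_tendsto_half[OF assms]]
  by (simp add: dist_coarse_class.abs_eq)

lemma SUP_infdist_coarse_class:
  assumes "church_stochastic_relative A B" "church_stochastic_relative B A"
  shows "(SUP x\<in>closure {coarse_class_of X | X. X \<le>\<^sub>T A}.
    infdist x (closure {coarse_class_of X | X. X \<le>\<^sub>T B})) = 1 / 2"
\<comment> \<open>Here s is the class of A and t the class of B: stochasticity of B gives the upper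
  bound, that of A the lower bound.\<close>
proof (rule SUP_infdist_closure_eq)
  show "coarse_class_of A \<in> {coarse_class_of X | X. X \<le>\<^sub>T A}"
    "coarse_class_of B \<in> {coarse_class_of X | X. X \<le>\<^sub>T B}"
    using turing_le_refl by blast+
  show "dist x (coarse_class_of B) \<le> 1 / 2" if "x \<in> {coarse_class_of X | X. X \<le>\<^sub>T A}" for x
    using that dist_coarse_class_half[OF assms(2)] by auto
  show "1 / 2 \<le> dist (coarse_class_of A) y" if "y \<in> {coarse_class_of X | X. X \<le>\<^sub>T B}" for y
    using that dist_coarse_class_half[OF assms(1)] by (auto simp: dist_commute)
qed

theorem theorem5p5:
  fixes A B :: "nat set"
  shows "(church_stochastic_relative B A \<longrightarrow> coarse_Gamma B A \<ge> 1 / 2) \<and>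
    (church_stochastic_relative A B \<and> church_stochastic_relative B A \<longrightarrow> coarse_H A B = 1 / 2)"
proof (intro conjI impI)
  assume "church_stochastic_relative B A"
  then show "coarse_Gamma B A \<ge> 1 / 2"
    by (rule coarse_Gamma_ge_half)
next
  assume "church_stochastic_relative A B \<and> church_stochastic_relative B A"
  then have AB: "church_stochastic_relative A B" "church_stochastic_relative B A"
    by blast+
  show "coarse_H A B = 1 / 2"
    \<comment> \<open>The hypothesis is symmetric, so exchanging A and B gives the other one-sided
      supremum.\<close>
    unfolding coarse_H_def hausdorff_distance_def
      SUP_infdist_coarse_class[OF AB] SUP_infdist_coarse_class[OF AB(2,1)] by simp
qed

end
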